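(* For any $\rho>0$, $\gamma>2\rho$, and any integer $N\ge\max\left\{\frac{\rho^2}{\gamma(\gamma-2\rho)},1\right\}$ there exists a $\rho$-negative comonotone single-valued operator $F:\mathbb{R}^d\to\mathbb{R}^d$ (for $d=2$), with solution $x^*$, such that the Proximal Point method with stepsize $\gamma$ started at any $x^0$ produces the iterate $x^{N+1}$ satisfying $$\|F(x^{N+1})\|^2\ge\frac{\|x^0-x^*\|^2}{\gamma(\gamma-2\rho)N\left(1+\frac1N\right)^{N+1}}.$$ Indeed, one can pick the two-dimensional operator $F:\mathbb{R}^2\to\mathbb{R}^2$, $F(x)=\alpha Ax$, with $$A=\begin{pmatrix}\cos\theta&-\sin\theta\\ \sin\theta&\cos\theta\end{pmatrix},\qquad \alpha=\frac{|\cos\theta|}{\rho},$$ where $\theta\in(\pi/2,\pi]$ is such that $\cos\theta=-\frac{\rho}{\sqrt{N\gamma(\gamma-2\rho)}}$.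
   Context: A single-valued operator $F:\mathbb{R}^d\to\mathbb{R}^d$ is $\rho$-negative comonotone if $\langle F(x)-F(y),x-y\rangle\ge-\rho\|F(x)-F(y)\|^2$ for all $x,y\in\mathbb{R}^d$. A solution is a point $x^*$ with $F(x^* )=0$. The Proximal Point method with stepsize $\gamma$ generates from $x^0$ the sequence $(x^k)_{k\ge 0}$ defined implicitly by $x^{k+1}=x^k-\gamma F(x^{k+1})$, $k=0,1,2,\dots$. *)

theory Defs
  imports "HOL-Analysis.Analysis"
begin

definition neg_comonotone :: "real \<Rightarrow> ('a::real_inner \<Rightarrow> 'a) \<Rightarrow> bool" where
  "neg_comonotone \<rho> F \<longleftrightarrow>
     (\<forall>x y. (F x - F y) \<bullet> (x - y) \<ge> - \<rho> * (norm (F x - F y))\<^sup>2)"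

text \<open>The recursion is implicit, so this is a relation: for a general operator there may be
  no such sequence, or several.\<close>

definition proximal_point ::
    "real \<Rightarrow> ('a::real_inner \<Rightarrow> 'a) \<Rightarrow> 'a \<Rightarrow> (nat \<Rightarrow> 'a) \<Rightarrow> bool" where
  "proximal_point \<gamma> F x0 x \<longleftrightarrow>
     x 0 = x0 \<and> (\<forall>k. x (Suc k) = x k - \<gamma> *\<^sub>R F (x (Suc k)))"

text \<open>The lower bound for one operator. The unique existence of the sequence says that the
  method is well defined from every starting point, so that the bound is not vacuous.\<close>

definition pp_lower_bound ::
    "real \<Rightarrow> real \<Rightarrow> nat \<Rightarrow> ('a::real_inner \<Rightarrow> 'a) \<Rightarrow> 'a \<Rightarrow> bool" where
  "pp_lower_bound \<rho> \<gamma> N F xstar \<longleftrightarrow>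
     (\<forall>x0. (\<exists>!x. proximal_point \<gamma> F x0 x) \<and>
       (\<forall>x. proximal_point \<gamma> F x0 x \<longrightarrow>
          (norm (F (x (N + 1))))\<^sup>2 \<ge>
            (norm (x0 - xstar))\<^sup>2 / (\<gamma> * (\<gamma> - 2 * \<rho>) * real N * (1 + 1 / real N) ^ (N + 1))))"

definition rotation :: "real \<Rightarrow> real^2^2" where
  "rotation \<theta> = vector [vector [cos \<theta>, - sin \<theta>], vector [sin \<theta>, cos \<theta>]]"

definition scaled_rotation :: "real \<Rightarrow> real \<Rightarrow> real^2 \<Rightarrow> real^2" where
  "scaled_rotation \<rho> \<theta> x = (\<bar>cos \<theta>\<bar> / \<rho>) *\<^sub>R (rotation \<theta> *v x)"

end

theory Submission
  imports Defs
begin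

text \<open>
  For the scaled rotation \<open>F\<close>, the comonotonicity inequality and the lower bound both hold with
  equality, because \<open>F\<close> turns every vector by the same angle and scales it by the same \<open>\<alpha>\<close>. With
  \<open>cos \<theta> < 0\<close> and \<open>\<alpha> = \<bar>cos \<theta>\<bar> / \<rho>\<close> we have
  \<open>F x \<bullet> x = - \<alpha> \<bar>cos \<theta>\<bar> \<parallel>x\<parallel>\<^sup>2 = - \<rho> \<alpha>\<^sup>2 \<parallel>x\<parallel>\<^sup>2 = - \<rho> \<parallel>F x\<parallel>\<^sup>2\<close>, so by linearity \<open>F\<close> is
  \<open>\<rho>\<close>-negative comonotone with equality.

  One step of the method inverts the linear map \<open>G x = x + \<gamma> F x\<close>. Expanding the square gives
  \<open>\<parallel>G x\<parallel>\<^sup>2 = (1 + \<alpha>\<^sup>2 \<gamma> (\<gamma> - 2 \<rho>)) \<parallel>x\<parallel>\<^sup>2\<close>. The prescribed cosine is the one for which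
  \<open>\<alpha>\<^sup>2 = 1 / (N \<gamma> (\<gamma> - 2 \<rho>))\<close>, so the factor is \<open>1 + 1 / N\<close>. Hence \<open>G\<close> is a similarity, thus a
  bijection, and every step divides the squared norm by exactly \<open>1 + 1 / N\<close>. After \<open>N + 1\<close>
  steps \<open>\<parallel>F x\<parallel>\<^sup>2 = \<alpha>\<^sup>2 \<parallel>x\<parallel>\<^sup>2\<close> is exactly the claimed bound, with solution \<open>0\<close>. The condition
  \<open>N \<ge> \<rho>\<^sup>2 / (\<gamma> (\<gamma> - 2 \<rho>))\<close> says that the prescribed cosine is at least \<open>- 1\<close>, so that the angle exists.
\<close>

text \<open>The implicit step says that \<open>x (Suc k) + \<gamma> F (x (Suc k)) = x k\<close>, so a bijective
  \<open>x \<mapsto> x + \<gamma> F x\<close> turns the method into the iteration of its inverse, the resolvent of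
  \<open>F\<close>.\<close>

lemma proximal_point_ex1:
  fixes F :: "'a::real_inner \<Rightarrow> 'a"
  assumes "bij (\<lambda>x. x + \<gamma> *\<^sub>R F x)"
  shows "\<exists>!x. proximal_point \<gamma> F x0 x"
proof -
  define G where "G = (\<lambda>x. x + \<gamma> *\<^sub>R F x)"
  have G: "bij G"
    using assms by (simp add: G_def)
  have step: "b = a - \<gamma> *\<^sub>R F b \<longleftrightarrow> b = inv G a" for a b
  proof -
    have "b = a - \<gamma> *\<^sub>R F b \<longleftrightarrow> G b = a"
      by (auto simp: G_def algebra_simps)
    also have "\<dots> \<longleftrightarrow> b = inv G a"
      using G by (metis bij_inv_eq_iff)
    finally show ?thesis .
  qed
  have "proximal_point \<gamma> F x0 x \<longleftrightarrow> x = (\<lambda>k. (inv G ^^ k) x0)" for x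
  proof
    assume x: "proximal_point \<gamma> F x0 x"
    have "x k = (inv G ^^ k) x0" for k
      using x by (induction k) (auto simp: proximal_point_def step)
    then show "x = (\<lambda>k. (inv G ^^ k) x0)" ..
  qed (simp add: proximal_point_def step)
  then show ?thesis
    by simp
qed

lemma proximal_point_norm_geometric:
  fixes F :: "'a::real_inner \<Rightarrow> 'a"
  assumes "q > 0" and "\<And>x. (norm (x + \<gamma> *\<^sub>R F x))\<^sup>2 = q * (norm x)\<^sup>2"
    and "proximal_point \<gamma> F x0 x"
  shows "(norm (x k))\<^sup>2 = (norm x0)\<^sup>2 / q ^ k"
proof (induction k)
  case 0
  then show ?case
    using assms(3) by (simp add: proximal_point_def)
next
  case (Suc k)
  have "x (Suc k) + \<gamma> *\<^sub>R F (x (Suc k)) = x k"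
    using assms(3) unfolding proximal_point_def by (metis diff_add_cancel)
  then have "(norm (x k))\<^sup>2 = q * (norm (x (Suc k)))\<^sup>2"
    using assms(2) by metis
  then show ?case
    using Suc assms(1) by (simp add: field_simps)
qed

lemma linear_scaled_rotation: "linear (scaled_rotation \<rho> \<theta>)"
proof -
  have "linear (\<lambda>x. (\<bar>cos \<theta>\<bar> / \<rho>) *\<^sub>R (rotation \<theta> *v x))"
    by (intro linear_compose_scale_right matrix_vector_mul_linear)
  moreover have "scaled_rotation \<rho> \<theta> = (\<lambda>x. (\<bar>cos \<theta>\<bar> / \<rho>) *\<^sub>R (rotation \<theta> *v x))"
    by (simp add: scaled_rotation_def fun_eq_iff)
  ultimately show ?thesis
    by simp
qed

lemma inner_rotation: "(rotation \<theta> *v x) \<bullet> x = cos \<theta> * (norm x)\<^sup>2"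
  by (simp add: rotation_def power2_norm_eq_inner inner_vec_def sum_2
      matrix_vector_mult_def algebra_simps)

lemma norm_rotation: "(norm (rotation \<theta> *v x))\<^sup>2 = (norm x)\<^sup>2"
proof -
  have "(norm (rotation \<theta> *v x))\<^sup>2 = ((sin \<theta>)\<^sup>2 + (cos \<theta>)\<^sup>2) * (norm x)\<^sup>2"
    by (simp only: rotation_def power2_norm_eq_inner inner_vec_def sum_2
        matrix_vector_mult_def vec_lambda_beta vector_2 inner_real_def)
      (simp add: algebra_simps power2_eq_square
        del: sin_cos_squared_add sin_cos_squared_add2 sin_cos_squared_add3)
  then show ?thesis
    by simp
qed

lemma norm_scaled_rotation:
  "(norm (scaled_rotation \<rho> \<theta> x))\<^sup>2 = (cos \<theta> / \<rho>)\<^sup>2 * (norm x)\<^sup>2"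
  by (simp add: scaled_rotation_def power_mult_distrib norm_rotation power_divide)

lemma inner_scaled_rotation:
  assumes "\<rho> > 0" and "cos \<theta> \<le> 0"
  shows "scaled_rotation \<rho> \<theta> x \<bullet> x = - \<rho> * (norm (scaled_rotation \<rho> \<theta> x))\<^sup>2"
  unfolding norm_scaled_rotation
  using assms by (simp add: scaled_rotation_def inner_rotation field_simps power2_eq_square)

lemma neg_comonotone_scaled_rotation:
  assumes "\<rho> > 0" and "cos \<theta> \<le> 0"
  shows "neg_comonotone \<rho> (scaled_rotation \<rho> \<theta>)"
  unfolding neg_comonotone_def
  using inner_scaled_rotation[OF assms]
  by (simp flip: linear_diff[OF linear_scaled_rotation])

text \<open>Equality in the comonotonicity inequality makes the cross term of the expanded square a
  multiple of \<open>\<parallel>F x\<parallel>\<^sup>2\<close>, so it cancels part of \<open>\<gamma>\<^sup>2 \<parallel>F x\<parallel>\<^sup>2\<close> and leaves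
  \<open>\<gamma> (\<gamma> - 2 \<rho>) \<parallel>F x\<parallel>\<^sup>2\<close>.\<close>

lemma norm_resolvent_inverse:
  assumes "\<rho> > 0" and "cos \<theta> \<le> 0"
  shows "(norm (x + \<gamma> *\<^sub>R scaled_rotation \<rho> \<theta> x))\<^sup>2
    = (1 + (cos \<theta> / \<rho>)\<^sup>2 * (\<gamma> * (\<gamma> - 2 * \<rho>))) * (norm x)\<^sup>2"
proof -
  define v where "v = scaled_rotation \<rho> \<theta> x"
  have "(norm (x + \<gamma> *\<^sub>R v))\<^sup>2 = (norm x)\<^sup>2 + 2 * \<gamma> * (v \<bullet> x) + \<gamma>\<^sup>2 * (norm v)\<^sup>2"
    unfolding power2_norm_eq_inner
    by (simp add: inner_add_left inner_add_right inner_commute power2_eq_square)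
  also have "\<dots> = (norm x)\<^sup>2 + (\<gamma> * (\<gamma> - 2 * \<rho>)) * (norm v)\<^sup>2"
    using inner_scaled_rotation[OF assms, of x]
    by (simp add: v_def power2_eq_square algebra_simps)
  also have "\<dots> = (1 + (cos \<theta> / \<rho>)\<^sup>2 * (\<gamma> * (\<gamma> - 2 * \<rho>))) * (norm x)\<^sup>2"
    unfolding v_def norm_scaled_rotation by (simp add: algebra_simps)
  finally show ?thesis
    by (simp add: v_def)
qed

lemma linear_similarity_bij:
  fixes G :: "'a::euclidean_space \<Rightarrow> 'a"
  assumes "linear G" and "q > 0" and "\<And>x. (norm (G x))\<^sup>2 = q * (norm x)\<^sup>2"
  shows "bij G"
proof -
  have "x = 0" if "G x = 0" for x
    using assms(2) assms(3)[of x] that by simp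
  then have "inj G"
    using assms(1) by (simp add: linear_injective_0)
  then show ?thesis
    using assms(1) linear_injective_imp_surjective by (auto simp: bij_def)
qed

lemma pp_lower_bound_scaled_rotation:
  assumes "\<rho> > 0" and "\<gamma> > 2 * \<rho>" and "N \<ge> 1"
    and cos: "cos \<theta> = - \<rho> / sqrt (real N * \<gamma> * (\<gamma> - 2 * \<rho>))"
  shows "pp_lower_bound \<rho> \<gamma> N (scaled_rotation \<rho> \<theta>) 0"
proof -
  let ?F = "scaled_rotation \<rho> \<theta>" and ?P = "\<gamma> * (\<gamma> - 2 * \<rho>)" and ?q = "1 + 1 / real N"
  have P: "?P > 0" and N: "real N > 0"
    using assms by simp_all
  then have NP: "real N * \<gamma> * (\<gamma> - 2 * \<rho>) > 0"
    by (simp add: mult.assoc)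
  have cos_le: "cos \<theta> \<le> 0"
    using NP \<open>\<rho> > 0\<close> by (simp add: cos)
  have ratio: "(cos \<theta> / \<rho>)\<^sup>2 = 1 / (?P * real N)"
    using NP \<open>\<rho> > 0\<close> by (simp add: cos power_divide real_sqrt_pow2 mult_ac)
  have q: "?q > 0"
    using N by (simp add: add_pos_pos)
  have factor: "1 + (cos \<theta> / \<rho>)\<^sup>2 * ?P = ?q"
    unfolding ratio using P by (metis nonzero_divide_mult_cancel_left less_irrefl mult.commute
        times_divide_eq_right mult_1_right)
  have norm_G: "(norm (x + \<gamma> *\<^sub>R ?F x))\<^sup>2 = ?q * (norm x)\<^sup>2" for x
    using norm_resolvent_inverse[OF \<open>\<rho> > 0\<close> cos_le, of x \<gamma>] factor by simp
  have "linear (\<lambda>x. x + \<gamma> *\<^sub>R ?F x)"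
    by (intro linear_compose_add linear_compose_scale_right linear_scaled_rotation linear_ident)
  then have bij: "bij (\<lambda>x. x + \<gamma> *\<^sub>R ?F x)"
    using linear_similarity_bij q norm_G by blast
  have "(norm (?F (x (N + 1))))\<^sup>2 = (norm x0)\<^sup>2 / (?P * real N * ?q ^ (N + 1))"
    if "proximal_point \<gamma> ?F x0 x" for x0 x
    unfolding norm_scaled_rotation ratio proximal_point_norm_geometric[OF q norm_G that]
    by simp
  then show ?thesis
    using proximal_point_ex1[OF bij] by (simp add: pp_lower_bound_def)
qed

theorem theorem3p2:
  fixes \<rho> \<gamma> :: real and N :: nat
  assumes "\<rho> > 0" and "\<gamma> > 2 * \<rho>"
    and "real N \<ge> max (\<rho>\<^sup>2 / (\<gamma> * (\<gamma> - 2 * \<rho>))) 1"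
  shows "(\<exists>(F :: real^2 \<Rightarrow> real^2) xstar.
            neg_comonotone \<rho> F \<and> F xstar = 0 \<and> pp_lower_bound \<rho> \<gamma> N F xstar) \<and>
         (\<exists>\<theta>. pi / 2 < \<theta> \<and> \<theta> \<le> pi \<and>
            cos \<theta> = - \<rho> / sqrt (real N * \<gamma> * (\<gamma> - 2 * \<rho>))) \<and>
         (\<forall>\<theta>. pi / 2 < \<theta> \<and> \<theta> \<le> pi \<and>
            cos \<theta> = - \<rho> / sqrt (real N * \<gamma> * (\<gamma> - 2 * \<rho>)) \<longrightarrow>
            neg_comonotone \<rho> (scaled_rotation \<rho> \<theta>) \<and>
            (\<exists>xstar. scaled_rotation \<rho> \<theta> xstar = 0 \<and>
               pp_lower_bound \<rho> \<gamma> N (scaled_rotation \<rho> \<theta>) xstar))"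
proof -
  define s where "s = sqrt (real N * \<gamma> * (\<gamma> - 2 * \<rho>))"
  have P: "\<gamma> * (\<gamma> - 2 * \<rho>) > 0" and N: "N \<ge> 1"
    using assms by simp_all
  then have s: "s > 0"
    by (simp add: s_def mult.assoc)
  \<comment> \<open>The condition \<open>N \<ge> \<rho>\<^sup>2 / (\<gamma> (\<gamma> - 2 \<rho>))\<close> makes \<open>- \<rho> / s\<close> a value of the cosine.\<close>
  have "\<rho>\<^sup>2 \<le> real N * \<gamma> * (\<gamma> - 2 * \<rho>)"
    using assms(3) P by (simp add: pos_divide_le_eq mult.assoc)
  then have "\<rho> \<le> s"
    unfolding s_def by (rule real_le_rsqrt)
  then have range: "- 1 \<le> - \<rho> / s" "- \<rho> / s < 0"
    using s \<open>\<rho> > 0\<close> by simp_all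
  define \<theta>0 where "\<theta>0 = arccos (- \<rho> / s)"
  have cos0: "cos \<theta>0 = - \<rho> / s" and bounds0: "0 \<le> \<theta>0" "\<theta>0 \<le> pi"
    unfolding \<theta>0_def using range by (simp_all add: cos_arccos arccos_lbound arccos_ubound)
  have "pi / 2 < \<theta>0"
  proof (rule ccontr)
    assume "\<not> pi / 2 < \<theta>0"
    then have "cos \<theta>0 \<ge> 0"
      using bounds0 by (intro cos_ge_zero) auto
    then show False
      using cos0 range by simp
  qed
  then have angle: "\<exists>\<theta>. pi / 2 < \<theta> \<and> \<theta> \<le> pi \<and> cos \<theta> = - \<rho> / s"
    using bounds0 cos0 by blast
  have rotation: "neg_comonotone \<rho> (scaled_rotation \<rho> \<theta>) \<and> scaled_rotation \<rho> \<theta> 0 = 0 \<and>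
      pp_lower_bound \<rho> \<gamma> N (scaled_rotation \<rho> \<theta>) 0" if "cos \<theta> = - \<rho> / s" for \<theta>
    using neg_comonotone_scaled_rotation[of \<rho> \<theta>] linear_0[OF linear_scaled_rotation]
      pp_lower_bound_scaled_rotation[OF assms(1,2) N] that range(2) \<open>\<rho> > 0\<close>
    by (simp add: s_def)
  show ?thesis
    using angle rotation unfolding s_def by blast
qed

end
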